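(* Neither $\mathtt{NS^*}$ nor $\mathtt{S^*N}$ occurs as a subsequence of the sepr-sequence of any Hermitian matrix.
   Context: Let $B \in \mathbb{C}^{n\times n}$ be Hermitian. For $\alpha\subseteq\{1,\dots,n\}$ with $|\alpha|=k\ge 1$, the determinant of the submatrix $B[\alpha]$ lying in the rows and columns indexed by $\alpha$ is a principal minor of order $k$ (it is a real number). The signed enhanced principal rank characteristic sequence (sepr-sequence) of $B$ is $\operatorname{sepr}(B)=t_1t_2\cdots t_n$, where each $t_k$ is one of the seven symbols $\mathtt{A^*},\mathtt{A^+},\mathtt{A^-},\mathtt{N},\mathtt{S^*},\mathtt{S^+},\mathtt{S^-}$, determined as follows: - $t_k=\mathtt{A^*}$ if all order-$k$ principal minors of $B$ are nonzero and there are both positive and negative ones; - $t_k=\mathtt{A^+}$ (respectively $\mathtt{A^-}$) if all order-$k$ principal minors of $B$ are positive (respectively negative); - $t_k=\mathtt{N}$ if all order-$k$ principal minors of $B$ are zero; - $t_k=\mathtt{S^*}$ if $B$ has a positive, a negative and a zero order-$k$ principal minor; - $t_k=\mathtt{S^+}$ (respectively $\mathtt{S^-}$) if $B$ has both a zero and a nonzero order-$k$ principal minor and all nonzero order-$k$ principal minors are positive (respectively negative). A subsequence of $x_1x_2\cdots x_n$ means a block of consecutive terms $x_px_{p+1}\cdots x_q$ with $1\le p\le q\le n$. *)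

theory Defs
  imports
    "Jordan_Normal_Form.Schur_Decomposition"
    "Jordan_Normal_Form.DL_Submatrix"
    "HOL-Library.Sublist"
    "HOL-Library.Complex_Order"
begin

definition hermitian :: "complex mat \<Rightarrow> bool" where
  "hermitian B \<longleftrightarrow> mat_adjoint B = B"

text \<open>Rows and columns are numbered from 0, so the index sets are the subsets of
  \<open>{..<n}\<close> instead of \<open>{1..n}\<close>.\<close>

definition principal_minors :: "complex mat \<Rightarrow> nat \<Rightarrow> complex set" where
  "principal_minors B k =
     {det (submatrix B \<alpha> \<alpha>) | \<alpha>. \<alpha> \<subseteq> {..<dim_row B} \<and> card \<alpha> = k}"

datatype sepr_symbol = AStar | APlus | AMinus | N | SStar | SPlus | SMinus

text \<open>The order on \<^typ>\<open>complex\<close> is that of \<^theory>\<open>HOL-Library.Complex_Order\<close>: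
  \<open>0 < z\<close> says that \<open>z\<close> is real and positive, and \<open>z < 0\<close> that \<open>z\<close> is real and negative.
  The principal minors of a Hermitian matrix are real, so for such a matrix of size \<open>n\<close> and
  \<open>1 \<le> k \<le> n\<close> exactly one of the seven conditions below holds, and the value
  \<^term>\<open>undefined\<close> does not arise.\<close>

definition sepr_term :: "complex mat \<Rightarrow> nat \<Rightarrow> sepr_symbol" where
  "sepr_term B k =
     (let M = principal_minors B k in
      if (\<forall>x\<in>M. x \<noteq> 0) \<and> (\<exists>x\<in>M. 0 < x) \<and> (\<exists>x\<in>M. x < 0) then AStar
      else if \<forall>x\<in>M. 0 < x then APlus
      else if \<forall>x\<in>M. x < 0 then AMinus
      else if \<forall>x\<in>M. x = 0 then N
      else if (\<exists>x\<in>M. 0 < x) \<and> (\<exists>x\<in>M. x < 0) \<and> (\<exists>x\<in>M. x = 0) then SStar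
      else if (\<exists>x\<in>M. x = 0) \<and> (\<exists>x\<in>M. x \<noteq> 0) \<and> (\<forall>x\<in>M. x \<noteq> 0 \<longrightarrow> 0 < x) then SPlus
      else if (\<exists>x\<in>M. x = 0) \<and> (\<exists>x\<in>M. x \<noteq> 0) \<and> (\<forall>x\<in>M. x \<noteq> 0 \<longrightarrow> x < 0) then SMinus
      else undefined)"

definition sepr :: "complex mat \<Rightarrow> sepr_symbol list" where
  "sepr B = map (sepr_term B) [1..<Suc (dim_row B)]"

end

theory Submission
  imports Defs
begin

text \<open>The two patterns are one phenomenon. Suppose that all principal minors of order \<open>m\<close> of the
  Hermitian matrix \<open>B\<close> vanish. Then all nonzero principal minors of order \<open>m + 1\<close> have one sign,
  and all nonzero ones of order \<open>m - 1\<close> have the opposite sign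
  (\<open>zero_order_neighbouring_signs\<close>). Hence neither neighbour of an \<open>N\<close> can be \<open>S\<^sup>*\<close>.

  The tool is the principal pivot transform. If \<open>B[S]\<close> is nonsingular, there is a matrix \<open>A\<close> with
  \<open>det B[S \<triangle> T] = det B[S] \<cdot> det A[T]\<close> for every \<open>T\<close> (\<open>minor_sym_diff\<close>), where \<open>\<triangle>\<close> is the
  symmetric difference; it inherits from \<open>B\<close> the symmetry \<open>A\<^sub>j\<^sub>i = \<plusminus> cnj A\<^sub>i\<^sub>j\<close>, with the
  minus sign exactly when one of \<open>i\<close>, \<open>j\<close> lies in \<open>S\<close> and the other does not
  (\<open>pivot_symmetry\<close>).

  Let \<open>B[S]\<close> and \<open>B[T]\<close> be nonsingular and \<open>i \<in> S \<triangle> T\<close>. The minor of \<open>A\<close> on \<open>S \<triangle> T\<close> is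
  nonzero, so row \<open>i\<close> of \<open>A\<close> has a nonzero entry \<open>A\<^sub>i\<^sub>j\<close> with \<open>j \<in> S \<triangle> T\<close>. If
  \<open>S \<triangle> {i}\<close> is singular, then \<open>A\<^sub>i\<^sub>i = 0\<close>, hence \<open>j \<noteq> i\<close> and the minor of \<open>A\<close> on \<open>{i, j}\<close>
  is \<open>- A\<^sub>i\<^sub>j A\<^sub>j\<^sub>i\<close>, which is \<open>\<bar>A\<^sub>i\<^sub>j\<bar>\<^sup>2\<close> up to a known sign. So moving from \<open>S\<close> to
  \<open>S \<triangle> {i, j}\<close> comes two elements closer to \<open>T\<close>, stays among the nonsingular index sets, and
  changes the sign of the minor exactly when the size changes by two (\<open>minor_exchange\<close>).

  Start from a nonsingular set of size \<open>m - 1\<close> or \<open>m + 1\<close> and choose \<open>i\<close> so that \<open>S \<triangle> {i}\<close> has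
  size \<open>m\<close>. The hypothesis applies at each step, the sizes stay in \<open>{m - 1, m + 1}\<close>, and the sign
  of the minor, reversed for the smaller size, is constant along the walk from \<open>S\<close> to
  \<open>T\<close>.\<close>

section \<open>Principal minors as Leibniz sums\<close>

text \<open>Summing over the permutations of \<open>S\<close> itself keeps the original row and column numbers,
  so that principal minors on different index sets can be compared without renumbering.\<close>

definition minor :: "complex mat \<Rightarrow> nat set \<Rightarrow> complex" where
  "minor A S = (\<Sum>p | p permutes S. signof p * (\<Prod>i\<in>S. A $$ (i, p i)))"

lemma bij_betw_pick:
  assumes "finite S"
  shows "bij_betw (pick S) {0..<card S} S"
proof -
  have inj: "inj_on (pick S) {0..<card S}"
    by (rule linorder_inj_onI) (auto dest: pick_mono_le[where S = S])
  moreover have "pick S ` {0..<card S} \<subseteq> S"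
    using pick_in_set_le by auto
  ultimately have "pick S ` {0..<card S} = S"
    using assms by (intro card_subset_eq) (auto simp: card_image)
  with inj show ?thesis
    by (simp add: bij_betw_def)
qed

lemma principal_submatrix_carrier:
  assumes "A \<in> carrier_mat n n" and "S \<subseteq> {..<n}"
  shows "submatrix A S S \<in> carrier_mat (card S) (card S)"
proof -
  have "{i. i < n \<and> i \<in> S} = S" using assms(2) by auto
  then show ?thesis
    using carrier_matD[OF assms(1)] by (intro carrier_matI) (auto simp: dim_submatrix)
qed

text \<open>Renumbering the elements of \<open>S\<close> in increasing order carries the permutations of
  \<open>{0..<card S}\<close> to those of \<open>S\<close> and keeps their signs, so the two Leibniz sums agree term
  by term.\<close>

lemma det_submatrix_eq_minor:
  assumes A: "A \<in> carrier_mat n n" and S: "S \<subseteq> {..<n}"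
  shows "det (submatrix A S S) = minor A S"
proof -
  let ?k = "card S" and ?f = "pick S"
  have fin: "finite S" using S finite_subset by blast
  have S': "{i. i < n \<and> i \<in> S} = S" using S by auto
  have f: "bij_betw ?f {0..<?k} S" by (rule bij_betw_pick[OF fin])
  let ?g = "inv_into {0..<?k} ?f"
  have g: "bij_betw ?g S {0..<?k}" by (rule bij_betw_inv_into[OF f])
  have gf: "?g (?f x) = x" if "x \<in> {0..<?k}" for x
    using f that by (meson bij_betw_inv_into_left)
  have fg: "?f (?g x) = x" if "x \<in> S" for x
    using f that by (meson bij_betw_inv_into_right)
  have sub: "submatrix A S S \<in> carrier_mat ?k ?k"
    by (rule principal_submatrix_carrier[OF A S])
  have idx: "submatrix A S S $$ (i, j) = A $$ (?f i, ?f j)" if "i < ?k" "j < ?k" for i j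
    using A S' that by (intro submatrix_index) auto
  have "det (submatrix A S S) = (\<Sum>p | p permutes {0..<?k}. signof p * (\<Prod>i = 0..<?k. submatrix A S S $$ (i, p i)))"
    by (rule det_def'[OF sub])
  also have "\<dots> = minor A S"
    unfolding minor_def
  proof (rule sum.reindex_bij_witness[where i = "map_permutation S ?g"
        and j = "map_permutation {0..<?k} ?f"], goal_cases)
    case (1 p)
    then show ?case using f gf by (intro map_permutation_compose_inv) auto
  next
    case (2 p)
    then show ?case using f by (auto intro: map_permutation_permutes)
  next
    case (3 p)
    then show ?case using g fg by (intro map_permutation_compose_inv) auto
  next
    case (4 p)
    then show ?case using g by (auto intro: map_permutation_permutes)
  next
    case (5 p)
    let ?q = "map_permutation {0..<?k} ?f p"
    have p: "p permutes {0..<?k}" using 5 by simp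
    have "signof ?q = (signof p :: complex)"
      using p f by (simp add: sign_map_permutation bij_betw_def)
    moreover have "(\<Prod>i\<in>S. A $$ (i, ?q i)) = (\<Prod>i = 0..<?k. submatrix A S S $$ (i, p i))"
    proof (subst prod.reindex_bij_betw[OF f, symmetric], rule prod.cong[OF refl])
      fix i assume i: "i \<in> {0..<?k}"
      then have "p i < ?k" using permutes_in_image[OF p, of i] by simp
      then show "A $$ (?f i, ?q (?f i)) = submatrix A S S $$ (i, p i)"
        using f i by (subst idx) (auto simp: map_permutation_apply bij_betw_def)
    qed
    ultimately show ?case by simp
  qed
  finally show ?thesis .
qed

text \<open>The matrix with the columns of \<open>A\<close> on \<open>S\<close> and unit vectors elsewhere is an
  \<open>n \<times> n\<close> matrix whose determinant is the minor on \<open>S\<close>. All minors thus become determinants of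
  one size, to which multiplicativity applies.\<close>

definition unit_cols :: "nat \<Rightarrow> complex mat \<Rightarrow> nat set \<Rightarrow> complex mat" where
  "unit_cols n A S = mat n n (\<lambda>(i, j). if j \<in> S then A $$ (i, j) else if i = j then 1 else 0)"

lemma unit_cols_carrier [simp]: "unit_cols n A S \<in> carrier_mat n n"
  by (simp add: unit_cols_def)

text \<open>A permutation that moves some \<open>j \<notin> S\<close> meets an off-diagonal zero of the unit column
  \<open>j\<close>; the others are the permutations of \<open>S\<close>, and for them the factors outside \<open>S\<close> are 1.\<close>

lemma det_unit_cols:
  assumes S: "S \<subseteq> {..<n}"
  shows "det (unit_cols n A S) = minor A S"
proof -
  let ?M = "unit_cols n A S"
  have "det ?M = (\<Sum>p | p permutes {0..<n}. signof p * (\<Prod>i = 0..<n. ?M $$ (i, p i)))"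
    by (rule det_def') simp
  also have "\<dots> = (\<Sum>p | p permutes S. signof p * (\<Prod>i = 0..<n. ?M $$ (i, p i)))"
  proof (rule sum.mono_neutral_right)
    show "finite {p. p permutes {0..<n}}" by (simp add: finite_permutations)
    show "{p. p permutes S} \<subseteq> {p. p permutes {0..<n}}"
      using S by (auto intro!: permutes_subset[of _ S "{0..<n}"])
    show "\<forall>p\<in>{p. p permutes {0..<n}} - {p. p permutes S}.
            signof p * (\<Prod>i = 0..<n. ?M $$ (i, p i)) = 0"
    proof
      fix p assume "p \<in> {p. p permutes {0..<n}} - {p. p permutes S}"
      then have p: "p permutes {0..<n}" and np: "\<not> p permutes S" by auto
      then obtain j where j: "j \<in> {0..<n}" "j \<notin> S" "p j \<noteq> j"
        using permutes_superset[OF p, of S] by auto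
      obtain i where i: "p i = j" using permutes_surj[OF p] by (metis surj_def)
      then have i': "i \<in> {0..<n}" using permutes_in_image[OF p, of i] j by simp
      have "?M $$ (i, p i) = 0"
        using i i' j by (cases "i = j") (auto simp: unit_cols_def)
      then show "signof p * (\<Prod>i = 0..<n. ?M $$ (i, p i)) = 0"
        using i' by (auto intro!: prod_zero)
    qed
  qed
  also have "\<dots> = minor A S"
    unfolding minor_def
  proof (rule sum.cong[OF refl])
    fix p assume "p \<in> {p. p permutes S}"
    then have p: "p permutes S" by simp
    have "(\<Prod>i = 0..<n. ?M $$ (i, p i)) = (\<Prod>i\<in>S. ?M $$ (i, p i))"
      using S p by (intro prod.mono_neutral_right) (auto simp: unit_cols_def permutes_not_in)
    also have "\<dots> = (\<Prod>i\<in>S. A $$ (i, p i))"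
    proof (rule prod.cong[OF refl])
      fix i assume "i \<in> S"
      moreover from this have "p i \<in> S" using permutes_in_image[OF p] by simp
      moreover have "i < n" "p i < n" using calculation S by auto
      ultimately show "?M $$ (i, p i) = A $$ (i, p i)"
        by (simp add: unit_cols_def)
    qed
    finally show "signof p * (\<Prod>i = 0..<n. ?M $$ (i, p i)) = signof p * (\<Prod>i\<in>S. A $$ (i, p i))"
      by simp
  qed
  finally show ?thesis .
qed

lemma minor_singleton: "minor A {i} = A $$ (i, i)"
  by (simp add: minor_def)

lemma minor_doubleton:
  assumes "i \<noteq> j"
  shows "minor A {i, j} = A $$ (i, i) * A $$ (j, j) - A $$ (i, j) * A $$ (j, i)"
proof -
  have "id \<noteq> Transposition.transpose i j"
    using assms by (metis id_apply transpose_apply_first)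
  moreover have "{p. p permutes {i, j}} = {id, Transposition.transpose i j}"
    by (auto simp: permutes_doubleton_iff)
  ultimately show ?thesis
    using assms by (simp add: minor_def sign_swap_id)
qed

section \<open>The principal pivot transform\<close>

text \<open>If \<open>S\<close> comes first and \<open>B\<close> has the blocks \<open>P, Q\<close> over \<open>R, W\<close> with \<open>P = B[S]\<close>
  invertible, then \<open>A\<close> has the blocks \<open>P\<^sup>-\<^sup>1, P\<^sup>-\<^sup>1 Q\<close> over
  \<open>- R P\<^sup>-\<^sup>1, W - R P\<^sup>-\<^sup>1 Q\<close>. The defining equation avoids the block decomposition and the
  inverse.\<close>

definition is_pivot :: "nat \<Rightarrow> complex mat \<Rightarrow> nat set \<Rightarrow> complex mat \<Rightarrow> bool" where
  "is_pivot n B S A \<longleftrightarrow> A \<in> carrier_mat n n \<and> unit_cols n B S * A = unit_cols n B (- S)"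

lemma pivot_exists:
  assumes "S \<subseteq> {..<n}" and "minor B S \<noteq> 0"
  obtains A where "is_pivot n B S A"
proof -
  let ?T = "unit_cols n B S"
  have "?T \<in> Units (ring_mat TYPE(complex) n ())"
    using assms by (intro det_non_zero_imp_unit) (auto simp: det_unit_cols)
  then obtain R where R: "R \<in> carrier_mat n n" "?T * R = 1\<^sub>m n"
    by (auto simp: Units_def ring_mat_def)
  have "?T * (R * unit_cols n B (- S)) = (?T * R) * unit_cols n B (- S)"
    using R by (intro assoc_mult_mat[of _ n n _ n _ n, symmetric]) auto
  also have "\<dots> = unit_cols n B (- S)"
    using R by (simp add: left_mult_one_mat[OF unit_cols_carrier])
  finally show ?thesis
    using R that[of "R * unit_cols n B (- S)"] by (simp add: is_pivot_def mult_carrier_mat[OF R(1) unit_cols_carrier])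
qed

text \<open>Multiplication by the matrix \<open>unit_cols n B S\<close> sends the unit vector of index \<open>j\<close> to its
  own column \<open>j\<close>, and column \<open>j\<close> of the pivot to column \<open>j\<close> of the complementary matrix
  \<open>unit_cols n B (- S)\<close>. Replacing the unit vectors by columns of the pivot on \<open>T\<close> therefore
  toggles membership in \<open>S\<close> for the indices in \<open>T\<close>; take determinants.\<close>

lemma minor_sym_diff:
  assumes A: "is_pivot n B S A" and S: "S \<subseteq> {..<n}" and T: "T \<subseteq> {..<n}"
  shows "minor B (sym_diff S T) = minor B S * minor A T"
proof -
  let ?P = "unit_cols n B S"
  have "?P * unit_cols n A T = unit_cols n B (sym_diff S T)"
  proof (rule eq_matI)
    fix l j assume "l < dim_row (unit_cols n B (sym_diff S T))"
      and "j < dim_col (unit_cols n B (sym_diff S T))"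
    then have l: "l < n" and j: "j < n" by (auto simp: unit_cols_def)
    have lhs: "(?P * unit_cols n A T) $$ (l, j) = row ?P l \<bullet> col (unit_cols n A T) j"
      using l j by (simp add: unit_cols_def)
    show "(?P * unit_cols n A T) $$ (l, j) = unit_cols n B (sym_diff S T) $$ (l, j)"
    proof (cases "j \<in> T")
      case True
      have "col (unit_cols n A T) j = col A j"
        using True j A by (auto simp: unit_cols_def is_pivot_def intro!: eq_vecI)
      then have "(?P * unit_cols n A T) $$ (l, j) = (?P * A) $$ (l, j)"
        unfolding lhs using l j A
        by (subst index_mult_mat) (auto simp: is_pivot_def carrier_matD[OF unit_cols_carrier])
      also have "\<dots> = unit_cols n B (- S) $$ (l, j)"
        using A by (simp add: is_pivot_def)
      finally show ?thesis using True l j by (auto simp: unit_cols_def)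
    next
      case False
      have "col (unit_cols n A T) j = unit_vec n j"
        using False j by (auto simp: unit_cols_def intro!: eq_vecI)
      then have "(?P * unit_cols n A T) $$ (l, j) = ?P $$ (l, j)"
        using lhs l j by (simp add: unit_cols_def)
      then show ?thesis using False l j by (auto simp: unit_cols_def)
    qed
  qed (auto simp: unit_cols_def)
  then have "det (unit_cols n B (sym_diff S T)) = det ?P * det (unit_cols n A T)"
    by (metis det_mult unit_cols_carrier)
  moreover have "sym_diff S T \<subseteq> {..<n}" using S T by auto
  ultimately show ?thesis using S T by (simp add: det_unit_cols)
qed

lemma hermitian_index:
  assumes "B \<in> carrier_mat n n" and "hermitian B" and "i < n" and "j < n"
  shows "cnj (B $$ (i, j)) = B $$ (j, i)"
proof -
  have "mat_adjoint B $$ (j, i) = cnj (B $$ (i, j))"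
    using assms(1,3,4) by (simp add: mat_adjoint_def mat_of_rows_index)
  then show ?thesis using assms(2) by (simp add: hermitian_def)
qed

text \<open>Rearranging column \<open>k\<close> of the defining equation gives \<open>B u\<^sub>k = w\<^sub>k\<close> with vectors
  \<open>u\<^sub>k\<close>, \<open>w\<^sub>k\<close> that split column \<open>k\<close> of \<open>A\<close> and the unit vector of index \<open>k\<close> between
  \<open>S\<close> and its complement. As \<open>B\<close> is Hermitian, the inner products of \<open>u\<^sub>j\<close> with \<open>w\<^sub>i\<close> and of
  \<open>w\<^sub>j\<close> with \<open>u\<^sub>i\<close> agree. At each coordinate one of the two factors comes from a unit vector,
  so only the entries \<open>A\<^sub>i\<^sub>j\<close> and \<open>A\<^sub>j\<^sub>i\<close> survive.\<close>

lemma pivot_symmetry: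
  assumes B: "B \<in> carrier_mat n n" "hermitian B"
    and A: "is_pivot n B S A" and i: "i < n" and j: "j < n"
  shows "A $$ (j, i) = (if i \<in> S \<longleftrightarrow> j \<in> S then 1 else - 1) * cnj (A $$ (i, j))"
proof -
  define u where "u k l = (if l \<in> S then A $$ (l, k) else if l = k then - 1 else 0)" for k l
  define w where "w k l = (if l \<notin> S then - (A $$ (l, k)) else if l = k then 1 else 0)" for k l
  have uw: "(\<Sum>m<n. B $$ (l, m) * u k m) = w k l" if l: "l < n" and k: "k < n" for k l
  proof -
    have "(unit_cols n B S * A) $$ (l, k) = (\<Sum>m<n. unit_cols n B S $$ (l, m) * A $$ (m, k))"
      using A l k by (subst index_mult_mat)
        (auto simp: is_pivot_def unit_cols_def[of n B S] scalar_prod_def atLeast0LessThan)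
    also have "\<dots> = (\<Sum>m<n. B $$ (l, m) * u k m + (if m = k then (if k \<in> S then 0 else B $$ (l, k)) else 0)
        + (if m = l then (if l \<in> S then 0 else A $$ (l, k)) else 0))"
      using l by (intro sum.cong) (auto simp: unit_cols_def u_def)
    also have "\<dots> = (\<Sum>m<n. B $$ (l, m) * u k m) + (if k \<in> S then 0 else B $$ (l, k))
        + (if l \<in> S then 0 else A $$ (l, k))"
      using l k by (simp add: sum.distrib)
    moreover have "(unit_cols n B S * A) $$ (l, k) = (if k \<in> S then (if l = k then 1 else 0) else B $$ (l, k))"
      using A l k by (simp add: is_pivot_def) (simp add: unit_cols_def)
    ultimately show ?thesis
      by (cases "l = k") (simp_all add: w_def algebra_simps eq_neg_iff_add_eq_0 split: if_splits)
  qed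
  have "(\<Sum>l<n. cnj (u j l) * w i l) = (\<Sum>l<n. \<Sum>m<n. cnj (u j l) * B $$ (l, m) * u i m)"
    using i by (intro sum.cong) (auto simp: uw[symmetric] sum_distrib_left mult.assoc)
  also have "\<dots> = (\<Sum>m<n. \<Sum>l<n. cnj (u j l) * B $$ (l, m) * u i m)"
    by (rule sum.swap)
  also have "\<dots> = (\<Sum>m<n. cnj (w j m) * u i m)"
    using j by (intro sum.cong)
      (auto simp: uw[symmetric] sum_distrib_left hermitian_index[OF B] mult_ac)
  finally have eq: "(\<Sum>l<n. cnj (u j l) * w i l) = (\<Sum>l<n. cnj (w j l) * u i l)" .
  have "(\<Sum>l<n. cnj (u j l) * w i l) =
      (\<Sum>l<n. (if l = i then (if i \<in> S then cnj (A $$ (i, j)) else 0) else 0)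
           + (if l = j then (if j \<in> S then 0 else A $$ (j, i)) else 0))"
    by (intro sum.cong) (auto simp: u_def w_def)
  moreover have "(\<Sum>l<n. cnj (w j l) * u i l) =
      (\<Sum>l<n. (if l = j then (if j \<in> S then A $$ (j, i) else 0) else 0)
           + (if l = i then (if i \<in> S then 0 else cnj (A $$ (i, j))) else 0))"
    by (intro sum.cong) (auto simp: u_def w_def)
  ultimately show ?thesis
    using eq i j by (auto simp: sum.distrib eq_neg_iff_add_eq_0 add.commute split: if_splits)
qed

section \<open>Exchange between nonsingular index sets\<close>

text \<open>This is the symmetric exchange axiom of delta-matroids for the nonsingular principal index
  sets of a Hermitian matrix, refined by the sign of the new minor. It is stated only for the case in
  which toggling \<open>i\<close> alone gives a singular set, as this forces the diagonal entry of the pivot at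
  \<open>i\<close> to vanish and thereby determines the sign.\<close>

lemma minor_exchange:
  assumes B: "B \<in> carrier_mat n n" "hermitian B"
    and S: "S \<subseteq> {..<n}" "minor B S \<noteq> 0" and T: "T \<subseteq> {..<n}" "minor B T \<noteq> 0"
    and i: "i \<in> sym_diff S T" and zero: "minor B (sym_diff S {i}) = 0"
  obtains j c where "j \<in> sym_diff S T" and "j \<noteq> i" and "0 < c"
    and "minor B (sym_diff S {i, j}) = (if i \<in> S \<longleftrightarrow> j \<in> S then - c else c) * minor B S"
proof -
  obtain A where A: "is_pivot n B S A"
    using pivot_exists[OF S] .
  let ?D = "sym_diff S T"
  have D: "?D \<subseteq> {..<n}" using S T by auto
  then have i': "i < n" using i by auto
  have "sym_diff S ?D = T" by auto
  then have nz: "minor A ?D \<noteq> 0"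
    using minor_sym_diff[OF A S(1) D] T(2) by auto
  have "\<exists>j\<in>?D. A $$ (i, j) \<noteq> 0"
  proof (rule ccontr)
    assume "\<not> ?thesis"
    then have "A $$ (i, p i) = 0" if "p permutes ?D" for p
      using permutes_in_image[OF that, of i] i by blast
    moreover have "finite ?D" using D finite_subset by blast
    ultimately have "minor A ?D = 0"
      using i unfolding minor_def by (intro sum.neutral) (auto intro!: prod_zero)
    with nz show False by simp
  qed
  then obtain j where j: "j \<in> ?D" "A $$ (i, j) \<noteq> 0" by blast
  then have j': "j < n" using D by auto
  have ii: "A $$ (i, i) = 0"
    using minor_sym_diff[OF A S(1), of "{i}"] i' zero S(2) by (simp add: minor_singleton)
  with j have ij: "j \<noteq> i" by auto
  let ?c = "A $$ (i, j) * cnj (A $$ (i, j))"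
  have "minor B (sym_diff S {i, j}) = minor B S * minor A {i, j}"
    using i' j' by (intro minor_sym_diff[OF A S(1)]) auto
  also have "minor A {i, j} = - (A $$ (i, j) * A $$ (j, i))"
    using ij ii by (simp add: minor_doubleton)
  also have "\<dots> = (if i \<in> S \<longleftrightarrow> j \<in> S then - ?c else ?c)"
    using pivot_symmetry[OF B A i' j'] by simp
  finally have "minor B (sym_diff S {i, j}) = (if i \<in> S \<longleftrightarrow> j \<in> S then - ?c else ?c) * minor B S"
    by (simp add: mult.commute)
  moreover have "0 < ?c"
    using j(2) conjugate_square_greater_0[of "A $$ (i, j)"] by simp
  ultimately show ?thesis using that j(1) ij by blast
qed

text \<open>The factor \<open>\<plusminus> 1\<close> reverses the signs for size \<open>m - 1\<close>, so that an exchange preserves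
  the sign of the product in all cases. The proof walks from \<open>S\<close> to \<open>T\<close>; the condition
  \<open>card S + 1 = m\<close> avoids truncated subtraction at \<open>m = 0\<close>.\<close>

lemma zero_order_neighbouring_signs:
  assumes B: "B \<in> carrier_mat n n" "hermitian B"
    and zero: "\<And>R. R \<subseteq> {..<n} \<Longrightarrow> card R = m \<Longrightarrow> minor B R = 0"
    and S: "S \<subseteq> {..<n}" "card S = m + 1 \<or> card S + 1 = m"
    and T: "T \<subseteq> {..<n}" "card T = m + 1 \<or> card T + 1 = m" "minor B T \<noteq> 0"
    and pos: "0 < (if card S = m + 1 then 1 else - 1) * minor B S"
  shows "0 < (if card T = m + 1 then 1 else - 1) * minor B T"
  using S pos
proof (induction "card (sym_diff S T)" arbitrary: S rule: less_induct)
  case less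
  have fS: "finite S" and fT: "finite T"
    using less.prems(1) T(1) finite_subset by blast+
  show ?case
  proof (cases "S = T")
    case True
    then show ?thesis using less.prems by simp
  next
    case False
    \<comment> \<open>An element to drop if \<open>S\<close> is the larger size and to add if it is the smaller one, so that
      toggling it leads to the order \<open>m\<close> on which all minors vanish.\<close>
    have "\<exists>i. if card S = m + 1 then i \<in> S - T else i \<in> T - S"
    proof (cases "card S = m + 1")
      case True
      have "\<not> S \<subseteq> T"
        using False T(2) True card_subset_eq[OF fT, of S] card_mono[OF fT, of S] by auto
      with True show ?thesis by auto
    next
      case nS: False
      have "\<not> T \<subseteq> S"
        using False T(2) nS less.prems(2) card_subset_eq[OF fS, of T] card_mono[OF fS, of T] by auto
      with nS show ?thesis by auto
    qed
    then obtain i where i: "if card S = m + 1 then i \<in> S - T else i \<in> T - S" by blast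
    then have iD: "i \<in> sym_diff S T" by (auto split: if_splits)
    then have i': "i < n" using less.prems(1) T(1) by auto
    have "card (sym_diff S {i}) = m"
      using i fS less.prems(2) by (auto split: if_splits simp: card_insert_if card_Diff_singleton)
    then have z: "minor B (sym_diff S {i}) = 0"
      using less.prems(1) i' by (intro zero) auto
    have nz: "minor B S \<noteq> 0" using less.prems(3) by auto
    obtain j c where j: "j \<in> sym_diff S T" "j \<noteq> i" and c: "0 < c"
      and eq: "minor B (sym_diff S {i, j}) = (if i \<in> S \<longleftrightarrow> j \<in> S then - c else c) * minor B S"
      using minor_exchange[OF B less.prems(1) nz T(1,3) iD z] .
    let ?R = "sym_diff S {i, j}"
    have R: "?R \<subseteq> {..<n}" using less.prems(1) T(1) i' j by auto
    have "sym_diff ?R T = sym_diff S T - {i, j}" using iD j(1) by auto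
    then have smaller: "card (sym_diff ?R T) < card (sym_diff S T)"
      using iD fS fT by (auto intro!: psubset_card_mono)
    have cR: "card ?R = (if i \<in> S \<longleftrightarrow> j \<in> S then (if i \<in> S then card S - 2 else card S + 2) else card S)"
    proof -
      consider "i \<in> S" "j \<in> S" | "i \<in> S" "j \<notin> S" | "i \<notin> S" "j \<in> S" | "i \<notin> S" "j \<notin> S" by blast
      then show ?thesis
      proof cases
        case 1
        then have "?R = S - {i, j}" by auto
        with 1 j(2) show ?thesis using fS by (simp add: card_Diff_subset)
      next
        case 2
        then have "?R = insert j (S - {i})" by auto
        with 2 show ?thesis using fS card_Suc_Diff1[OF fS] by simp
      next
        case 3
        then have "?R = insert i (S - {j})" by auto
        with 3 show ?thesis using fS card_Suc_Diff1[OF fS] by simp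
      next
        case 4
        then have "?R = insert i (insert j S)" by auto
        with 4 j(2) show ?thesis using fS by simp
      qed
    qed
    have "2 \<le> card S" if "i \<in> S" "j \<in> S"
      using that j(2) card_mono[OF fS, of "{i, j}"] by auto
    then have sizes: "card ?R = m + 1 \<or> card ?R + 1 = m"
      using cR i less.prems(2) by (auto split: if_splits)
    have "(if card ?R = m + 1 then 1 else - 1) * minor B ?R
        = c * ((if card S = m + 1 then 1 else - 1) * minor B S)"
      unfolding eq using cR i less.prems(2) by (auto split: if_splits)
    also have "0 < \<dots>" using c less.prems(3) by (auto simp: less_complex_def)
    finally show ?thesis
      by (rule less.hyps[OF smaller R sizes])
  qed
qed

section \<open>Reading the sequence\<close>

lemma minor_real:
  assumes B: "B \<in> carrier_mat n n" "hermitian B" and S: "S \<subseteq> {..<n}"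
  shows "cnj (minor B S) = minor B S"
proof -
  interpret cnj: comm_ring_hom cnj
    by unfold_locales auto
  let ?M = "submatrix B S S"
  have S': "{i. i < n \<and> i \<in> S} = S" using S by auto
  have M: "?M \<in> carrier_mat (card S) (card S)"
    by (rule principal_submatrix_carrier[OF B(1) S])
  have "map_mat cnj ?M = transpose_mat ?M"
  proof (rule eq_matI)
    fix i j assume "i < dim_row (transpose_mat ?M)" "j < dim_col (transpose_mat ?M)"
    then have ij: "i < card S" "j < card S" using M by auto
    then have "pick S i < n" "pick S j < n" using S pick_in_set_le by blast+
    then show "map_mat cnj ?M $$ (i, j) = transpose_mat ?M $$ (i, j)"
      using ij M B S' by (simp add: submatrix_index hermitian_index[OF B])
  qed (use M in auto)
  then have "cnj (det ?M) = det ?M"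
    using det_transpose[OF M] cnj.hom_det[of ?M] by simp
  then show ?thesis
    using det_submatrix_eq_minor[OF B(1) S] by simp
qed

text \<open>The real content is that the value \<open>undefined\<close>, which could be any of the seven symbols, is
  not reached: principal minors of a Hermitian matrix are real, so by trichotomy the first
  seven branches cover all cases. The statements then follow by inspection of the branches.\<close>

lemma sepr_term_N_SStar:
  assumes B: "B \<in> carrier_mat n n" "hermitian B"
  shows "sepr_term B k = N \<Longrightarrow> S \<subseteq> {..<n} \<Longrightarrow> card S = k \<Longrightarrow> minor B S = 0"
    and "sepr_term B k = SStar \<Longrightarrow> \<exists>S\<subseteq>{..<n}. card S = k \<and> 0 < minor B S"
    and "sepr_term B k = SStar \<Longrightarrow> \<exists>S\<subseteq>{..<n}. card S = k \<and> minor B S < 0"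
proof -
  let ?M = "principal_minors B k"
  have M: "?M = {minor B S | S. S \<subseteq> {..<n} \<and> card S = k}"
    unfolding principal_minors_def using carrier_matD[OF B(1)]
    by (intro Collect_cong ex_cong1) (auto simp: det_submatrix_eq_minor[OF B(1)])
  have real: "x = 0 \<or> 0 < x \<or> x < 0" if "x \<in> ?M" for x
  proof -
    have "cnj x = x" using that minor_real[OF B] unfolding M by auto
    then have "Im x = 0" by (simp add: complex_eq_iff)
    then show ?thesis by (auto simp: less_complex_def complex_eq_iff less_le)
  qed
  have pos: "0 < x \<longleftrightarrow> \<not> x < 0 \<and> x \<noteq> 0" if "x \<in> ?M" for x
    using real[OF that] by (auto simp: less_complex_def)
  \<comment> \<open>By trichotomy every branch condition is a Boolean combination of these three.\<close>
  define P Q Z where "P \<longleftrightarrow> (\<exists>x\<in>?M. 0 < x)" and "Q \<longleftrightarrow> (\<exists>x\<in>?M. x < 0)"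
    and "Z \<longleftrightarrow> (\<exists>x\<in>?M. x = 0)"
  note defs = P_def Q_def Z_def
  have "(\<forall>x\<in>?M. x \<noteq> 0) \<longleftrightarrow> \<not> Z" "(\<forall>x\<in>?M. 0 < x) \<longleftrightarrow> \<not> Q \<and> \<not> Z"
    "(\<forall>x\<in>?M. x < 0) \<longleftrightarrow> \<not> P \<and> \<not> Z" "(\<exists>x\<in>?M. x \<noteq> 0) \<longleftrightarrow> P \<or> Q"
    "(\<forall>x\<in>?M. x \<noteq> 0 \<longrightarrow> 0 < x) \<longleftrightarrow> \<not> Q" "(\<forall>x\<in>?M. x \<noteq> 0 \<longrightarrow> x < 0) \<longleftrightarrow> \<not> P"
    and zero: "(\<forall>x\<in>?M. x = 0) \<longleftrightarrow> \<not> P \<and> \<not> Q"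
    unfolding defs using pos by (auto simp: pos dest: less_imp_neq)
  then have cases: "sepr_term B k =
     (if \<not> Z \<and> P \<and> Q then AStar else if \<not> Q \<and> \<not> Z then APlus
      else if \<not> P \<and> \<not> Z then AMinus else if \<not> P \<and> \<not> Q then N
      else if P \<and> Q \<and> Z then SStar else if Z \<and> (P \<or> Q) \<and> \<not> Q then SPlus
      else if Z \<and> (P \<or> Q) \<and> \<not> P then SMinus else undefined)"
    unfolding sepr_term_def Let_def by (simp only: flip: defs)
  have N: "\<forall>x\<in>?M. x = 0" if "sepr_term B k = N"
    using that cases unfolding zero by (auto split: if_splits)
  have SS: "P \<and> Q" if "sepr_term B k = SStar"
    using that cases by (auto split: if_splits)
  show "sepr_term B k = N \<Longrightarrow> S \<subseteq> {..<n} \<Longrightarrow> card S = k \<Longrightarrow> minor B S = 0"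
    using N unfolding M by blast
  show "sepr_term B k = SStar \<Longrightarrow> \<exists>S\<subseteq>{..<n}. card S = k \<and> 0 < minor B S"
    and "sepr_term B k = SStar \<Longrightarrow> \<exists>S\<subseteq>{..<n}. card S = k \<and> minor B S < 0"
    using SS unfolding defs M by blast+
qed

lemma sublist_seprD:
  assumes "sublist [a, b] (sepr B)"
  obtains k where "sepr_term B k = a" and "sepr_term B (Suc k) = b"
proof -
  from assms obtain ps ss where eq: "sepr B = ps @ [a, b] @ ss"
    by (auto simp: sublist_def)
  let ?l = "length ps"
  have len: "Suc ?l < dim_row B"
    using arg_cong[OF eq, of length] by (simp add: sepr_def del: upt_Suc)
  have "sepr B ! ?l = a" "sepr B ! Suc ?l = b"
    by (auto simp: eq nth_append)
  then show ?thesis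
    using len that[of "Suc ?l"] by (auto simp: sepr_def simp del: upt_Suc)
qed

theorem theorem4p1:
  fixes B :: "complex mat" and n :: nat
  assumes "B \<in> carrier_mat n n" and "hermitian B"
  shows "\<not> sublist [N, SStar] (sepr B) \<and> \<not> sublist [SStar, N] (sepr B)"
proof -
  have no: "\<not> (sepr_term B m = N \<and> sepr_term B k = SStar)"
    if mk: "k = m + 1 \<or> k + 1 = m" for m k
  proof
    assume terms: "sepr_term B m = N \<and> sepr_term B k = SStar"
    obtain S where S: "S \<subseteq> {..<n}" "card S = k" "0 < minor B S"
      using sepr_term_N_SStar(2)[OF assms] terms by blast
    obtain T where T: "T \<subseteq> {..<n}" "card T = k" "minor B T < 0"
      using sepr_term_N_SStar(3)[OF assms] terms by blast
    have zero: "minor B R = 0" if "R \<subseteq> {..<n}" "card R = m" for R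
      using sepr_term_N_SStar(1)[OF assms] terms that by blast
    have nz: "minor B S \<noteq> 0" "minor B T \<noteq> 0" using S(3) T(3) by auto
    have pos_neg: "\<not> minor B S < 0" "\<not> 0 < minor B T"
      using S(3) T(3) by (auto simp: less_complex_def)
    note same = zero_order_neighbouring_signs[OF assms zero]
    show False
    proof (cases "k = m + 1")
      case True
      then show ?thesis
        using same[of m S T] S T nz pos_neg by auto
    next
      case False
      then show ?thesis
        using same[of m T S] S T mk nz pos_neg by auto
    qed
  qed
  show ?thesis
    using no by (auto elim!: sublist_seprD)
qed

end
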